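(* Let $m, q_1, q_2, s_1, s_2$ be positive integers, and let $q = q_1 q_2$ and $s = s_1 s_2$. Suppose that for both $i = 1$ and $i = 2$, for every path and every partition $V_1 \sqcup \dots \sqcup V_m$ of its vertex set into $m$ parts with $|V_j| \ge q_i - 1$ for all $j$, there is an almost fair splitting by $q_i$ pairwise disjoint $s_i$-stable sets $A^{(i)}_1, \dots, A^{(i)}_{q_i}$. Then for every path and every partition $V_1 \sqcup \dots \sqcup V_m$ of its vertex set with $|V_j| \ge q-1$ for all $j$ there is an almost fair splitting by $q$ pairwise disjoint $s$-stable sets $S_1, \dots, S_q$. If moreover (in the hypothesis for $i=1$) the sets $A^{(1)}_1, \dots, A^{(1)}_{q_1}$ can always be chosen to be weakly $w_1$-stable for some fixed $w_1 \ge 2$, then there is an almost fair splitting by $q$ pairwise disjoint $[(s_2-1)(w_1-1)+1]$-stable sets $S_1, \dots, S_q$.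
   Context: A set $S$ of vertices of a path is $s$-stable if any two distinct vertices of $S$ are at distance at least $s$ in the path. Given a partition $V_1 \sqcup \dots \sqcup V_m$ of the vertex set, pairwise disjoint sets $S_1, \dots, S_r$ form an almost fair splitting (by $r$ sets) if $|S_i \cap V_j| \ge \lfloor \frac{|V_j|+1}{r} \rfloor - 1$ for all $i,j$ and $|V_j \setminus \bigcup_i S_i| \le r-1$ for all $j$. Weak stability: pairwise disjoint vertex sets $A_1, \dots, A_r$ of a path with vertices labeled $1, \dots, N$ in order are weakly $w$-stable if $|\bigcup_i A_i| = (w-1)n'+1$ for some integer $n'$ and, with $\varphi\colon \bigcup_i A_i \to \{1, \dots, (w-1)n'+1\}$ the order-preserving bijection, for every $i$ and every $k \in \{1, \dots, n'\}$ the set $\varphi(A_i) \cap \{(w-1)(k-1)+1, \dots, (w-1)k+1\}$ consists of exactly one point. *)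

theory Defs
  imports Complex_Main "HOL-Library.Disjoint_Sets"
begin

text \<open>The path with \<open>N\<close> vertices has vertex set \<open>{1..N}\<close>, labelled in order along the path.\<close>

definition path_arcs :: "nat \<Rightarrow> (nat \<times> nat) set" where
  "path_arcs N = {(x, y). x \<in> {1..N} \<and> y \<in> {1..N} \<and> (y = x + 1 \<or> x = y + 1)}"

definition path_dist :: "nat \<Rightarrow> nat \<Rightarrow> nat \<Rightarrow> nat" where
  "path_dist N x y = (LEAST k. (x, y) \<in> path_arcs N ^^ k)"

definition path_stable :: "nat \<Rightarrow> nat \<Rightarrow> nat set \<Rightarrow> bool" where
  "path_stable N s S \<longleftrightarrow>
     S \<subseteq> {1..N} \<and> (\<forall>x\<in>S. \<forall>y\<in>S. x \<noteq> y \<longrightarrow> path_dist N x y \<ge> s)"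

text \<open>Parts may be empty: the lower bound on the part sizes is the only size restriction.\<close>

definition path_partition :: "nat \<Rightarrow> nat \<Rightarrow> (nat \<Rightarrow> nat set) \<Rightarrow> bool" where
  "path_partition N m V \<longleftrightarrow>
     N \<ge> 1 \<and> disjoint_family_on V {1..m} \<and> (\<Union>j\<in>{1..m}. V j) = {1..N}"

definition almost_fair_splitting ::
    "nat \<Rightarrow> nat \<Rightarrow> (nat \<Rightarrow> nat set) \<Rightarrow> nat \<Rightarrow> (nat \<Rightarrow> nat set) \<Rightarrow> bool" where
  "almost_fair_splitting N m V r S \<longleftrightarrow>
     (\<forall>i\<in>{1..r}. S i \<subseteq> {1..N}) \<and> disjoint_family_on S {1..r} \<and>
     (\<forall>i\<in>{1..r}. \<forall>j\<in>{1..m}.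
        int (card (S i \<inter> V j)) \<ge> \<lfloor>(real (card (V j)) + 1) / real r\<rfloor> - 1) \<and>
     (\<forall>j\<in>{1..m}. int (card (V j - (\<Union>i\<in>{1..r}. S i))) \<le> int r - 1)"

text \<open>The order-preserving bijection \<open>\<phi>\<close> is unique, so it does not matter whether it is
  quantified existentially or universally.\<close>

definition weakly_stable :: "nat \<Rightarrow> nat \<Rightarrow> (nat \<Rightarrow> nat set) \<Rightarrow> bool" where
  "weakly_stable w r A \<longleftrightarrow>
     (\<exists>n::int. int (card (\<Union>i\<in>{1..r}. A i)) = (int w - 1) * n + 1 \<and>
        (\<exists>\<phi>::nat \<Rightarrow> int.
           bij_betw \<phi> (\<Union>i\<in>{1..r}. A i) {1..(int w - 1) * n + 1} \<and>
           strict_mono_on (\<Union>i\<in>{1..r}. A i) \<phi> \<and>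
           (\<forall>i\<in>{1..r}. \<forall>k\<in>{1..n}.
              card (\<phi> ` A i \<inter> {(int w - 1) * (k - 1) + 1..(int w - 1) * k + 1}) = 1)))"

lemma path_arcs_relpow_le:
  "(x, y) \<in> path_arcs N ^^ k \<Longrightarrow> nat \<bar>int x - int y\<bar> \<le> k"
proof (induction k arbitrary: y)
  case (Suc k)
  then obtain z where z: "(x, z) \<in> path_arcs N ^^ k" "(z, y) \<in> path_arcs N" by auto
  from Suc.IH[OF z(1)] z(2) show ?case by (auto simp: path_arcs_def)
qed simp

lemma path_arcs_relpow_up:
  "1 \<le> x \<Longrightarrow> x + k \<le> N \<Longrightarrow> (x, x + k) \<in> path_arcs N ^^ k"
proof (induction k)
  case (Suc k)
  then have "(x, x + k) \<in> path_arcs N ^^ k" "(x + k, x + Suc k) \<in> path_arcs N"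
    by (auto simp: path_arcs_def)
  then show ?case by auto
qed simp

lemma path_arcs_relpow_down:
  "1 \<le> x \<Longrightarrow> x + k \<le> N \<Longrightarrow> (x + k, x) \<in> path_arcs N ^^ k"
proof (induction k)
  case (Suc k)
  then have "(x + k, x) \<in> path_arcs N ^^ k" "(x + Suc k, x + k) \<in> path_arcs N"
    by (auto simp: path_arcs_def)
  then show ?case by (metis relpow_Suc_I2)
qed simp

lemma path_dist_eq:
  assumes "x \<in> {1..N}" "y \<in> {1..N}"
  shows "path_dist N x y = nat \<bar>int x - int y\<bar>"
  unfolding path_dist_def
proof (rule Least_equality)
  show "(x, y) \<in> path_arcs N ^^ nat \<bar>int x - int y\<bar>"
  proof (cases "x \<le> y")
    case True
    then have "nat \<bar>int x - int y\<bar> = y - x" by auto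
    with True assms path_arcs_relpow_up[of x "y - x" N] show ?thesis by simp
  next
    case False
    then have "nat \<bar>int x - int y\<bar> = x - y" by auto
    with False assms path_arcs_relpow_down[of y "x - y" N] show ?thesis by simp
  qed
qed (rule path_arcs_relpow_le)

end

theory Submission
  imports Defs
begin

text \<open>Split the path by \<open>q1\<close> sets \<open>A i\<close>, regard each \<open>A i\<close> as a path of its own by renumbering its
  vertices in order, and split it by \<open>q2\<close> sets. The fairness bounds multiply because
  \<open>\<lfloor>\<lfloor>x / q1\<rfloor> / q2\<rfloor> = \<lfloor>x / (q1 q2)\<rfloor>\<close>, and at most \<open>(q1 - 1) + q1 (q2 - 1) = q1 q2 - 1\<close> vertices of each part
  are lost. Two vertices of the same final set are at least \<open>s2\<close> steps apart inside \<open>A i\<close>, and each of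
  these steps has length at least \<open>s1\<close>. Under weak stability each step instead advances to
  a new window of \<open>w1 - 1\<close> consecutive positions of \<open>\<Union>i. A i\<close>.\<close>

section \<open>Stability and fairness in natural-number arithmetic\<close>

text \<open>Distance in a path is the absolute difference of labels, so by symmetry ordered pairs
  suffice. The additive form avoids truncated subtraction.\<close>

lemma path_stable_iff:
  "path_stable N s S \<longleftrightarrow> S \<subseteq> {1..N} \<and> (\<forall>x\<in>S. \<forall>y\<in>S. x < y \<longrightarrow> x + s \<le> y)"
proof -
  have "(\<forall>x\<in>S. \<forall>y\<in>S. x \<noteq> y \<longrightarrow> s \<le> path_dist N x y) \<longleftrightarrow>
        (\<forall>x\<in>S. \<forall>y\<in>S. x < y \<longrightarrow> x + s \<le> y)" (is "?L \<longleftrightarrow> ?R") if S: "S \<subseteq> {1..N}"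
  proof
    assume L: ?L
    show ?R
    proof (intro ballI impI)
      fix x y assume xy: "x \<in> S" "y \<in> S" "x < y"
      then have "s \<le> path_dist N x y" using L by auto
      moreover have "path_dist N x y = nat \<bar>int x - int y\<bar>"
        using xy S by (intro path_dist_eq) auto
      ultimately show "x + s \<le> y" using xy by linarith
    qed
  next
    assume R: ?R
    show ?L
    proof (intro ballI impI)
      fix x y assume xy: "x \<in> S" "y \<in> S" "x \<noteq> y"
      then have "x + s \<le> y \<or> y + s \<le> x" using R by (meson linorder_neqE_nat)
      moreover have "path_dist N x y = nat \<bar>int x - int y\<bar>"
        using xy S by (intro path_dist_eq) auto
      ultimately show "s \<le> path_dist N x y" by linarith
    qed
  qed
  then show ?thesis by (auto simp: path_stable_def)
qed

lemma floor_Suc_divide: "\<lfloor>(real c + 1) / real r\<rfloor> = int ((c + 1) div r)"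
  using floor_divide_of_nat_eq[of "c + 1" r, where 'a = real] by (simp add: add.commute)

text \<open>The floor is \<open>div\<close> on naturals, and each \<open>- 1\<close> moves to the
  other side of its inequality as \<open>+ 1\<close>; the bounds can then be composed with
  \<open>div_le_mono\<close> and \<open>div_mult2_eq\<close>.\<close>

lemma almost_fair_splitting_iff:
  "almost_fair_splitting N m V r S \<longleftrightarrow>
     (\<forall>i\<in>{1..r}. S i \<subseteq> {1..N}) \<and> disjoint_family_on S {1..r} \<and>
     (\<forall>i\<in>{1..r}. \<forall>j\<in>{1..m}. (card (V j) + 1) div r \<le> card (S i \<inter> V j) + 1) \<and>
     (\<forall>j\<in>{1..m}. card (V j - (\<Union>i\<in>{1..r}. S i)) + 1 \<le> r)"
proof -
  have "int b \<ge> \<lfloor>(real c + 1) / real r\<rfloor> - 1 \<longleftrightarrow> (c + 1) div r \<le> b + 1" for b c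
    unfolding floor_Suc_divide by linarith
  moreover have "int b \<le> int r - 1 \<longleftrightarrow> b + 1 \<le> r" for b
    by linarith
  ultimately show ?thesis
    unfolding almost_fair_splitting_def by presburger
qed

section \<open>Gaps and ranks in finite sets of labels\<close>

text \<open>Telescoping along consecutive elements of \<open>A\<close>: the cardinality is the
  number of steps from \<open>x\<close> to \<open>y\<close>. It serves twice, with \<open>f\<close>
  the label and \<open>g = s1\<close>, and with \<open>f\<close> a window index and
  \<open>g = 1\<close>.\<close>

lemma gap_mult_card_le:
  fixes f :: "nat \<Rightarrow> int"
  assumes gap: "\<And>u v. u \<in> A \<Longrightarrow> v \<in> A \<Longrightarrow> u < v \<Longrightarrow> f u + g \<le> f v"
    and "x \<in> A" "y \<in> A" "x \<le> y"
  shows "f x + g * int (card {a \<in> A. x < a \<and> a \<le> y}) \<le> f y"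
  using \<open>y \<in> A\<close> \<open>x \<le> y\<close>
proof (induction y rule: less_induct)
  case (less y)
  let ?B = "{a \<in> A. x \<le> a \<and> a < y}"
  show ?case
  proof (cases "x = y")
    case True
    then have empty: "{a \<in> A. x < a \<and> a \<le> y} = {}" by auto
    show ?thesis unfolding empty using True by simp
  next
    case False
    have fin: "finite ?B" by simp
    have "x \<in> ?B" using False less.prems \<open>x \<in> A\<close> by auto
    \<comment> \<open>\<open>z\<close> is the predecessor of \<open>y\<close> in \<open>A\<close>:
      induction handles \<open>x\<close> to \<open>z\<close>, and \<open>gap\<close> the last
      step.\<close>
    define z where "z = Max ?B"
    have "z \<in> ?B" unfolding z_def using fin \<open>x \<in> ?B\<close> by (intro Max_in) auto
    then have z: "z \<in> A" "x \<le> z" "z < y" by auto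
    have "{a \<in> A. x < a \<and> a \<le> y} = insert y {a \<in> A. x < a \<and> a \<le> z}"
    proof -
      have "a \<le> z" if "a \<in> A" "x < a" "a < y" for a
        unfolding z_def using that fin by (intro Max_ge) auto
      then show ?thesis using z less.prems by (auto simp: order.order_iff_strict)
    qed
    then have "card {a \<in> A. x < a \<and> a \<le> y} = Suc (card {a \<in> A. x < a \<and> a \<le> z})"
      using z by simp
    then show ?thesis
      using less.IH[OF \<open>z < y\<close> \<open>z \<in> A\<close> \<open>x \<le> z\<close>] gap[OF \<open>z \<in> A\<close> \<open>y \<in> A\<close> \<open>z < y\<close>]
      by (simp add: algebra_simps)
  qed
qed

text \<open>This renumbers \<open>A\<close> as a path. Ranks increase strictly because a larger
  element of \<open>A\<close> also counts itself; injectivity then yields surjectivity by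
  cardinality.\<close>

lemma rank_bij_betw:
  fixes A :: "nat set"
  assumes fin: "finite A"
  shows "bij_betw (\<lambda>x. card {a \<in> A. a \<le> x}) A {1..card A}"
proof -
  let ?r = "\<lambda>x. card {a \<in> A. a \<le> x}"
  have less: "?r x < ?r y" if "x \<in> A" "y \<in> A" "x < y" for x y
  proof (rule psubset_card_mono)
    have "y \<notin> {a \<in> A. a \<le> x}" "y \<in> {a \<in> A. a \<le> y}" using that by auto
    then show "{a \<in> A. a \<le> x} \<subset> {a \<in> A. a \<le> y}" using that by force
  qed (use fin in simp)
  have inj: "inj_on ?r A"
  proof (rule inj_onI)
    fix x y assume "x \<in> A" "y \<in> A" "?r x = ?r y"
    then show "x = y" using less[of x y] less[of y x] by (cases x y rule: linorder_cases) auto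
  qed
  have "?r ` A \<subseteq> {1..card A}"
  proof (intro image_subsetI)
    fix x assume "x \<in> A"
    then have "card {x} \<le> ?r x" using fin by (intro card_mono) auto
    moreover have "?r x \<le> card A" using fin by (intro card_mono) auto
    ultimately show "?r x \<in> {1..card A}" by simp
  qed
  moreover have "card (?r ` A) = card {1..card A}"
    using inj by (simp add: card_image)
  ultimately have "?r ` A = {1..card A}" by (intro card_subset_eq) auto
  with inj show ?thesis by (simp add: bij_betw_def)
qed

section \<open>Splitting a vertex subset as a path of its own\<close>

text \<open>The splitting of the renumbered path is pulled back along the rank map. Stability inside
  \<open>A\<close> is recorded as a count of elements of \<open>A\<close>, which equals the
  difference of ranks, so the renumbering does not appear in the conclusion.\<close>

lemma split_vertex_subset:
  fixes A :: "nat set"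
  assumes split: "\<forall>N V. path_partition N m V \<and> (\<forall>j\<in>{1..m}. int (card (V j)) \<ge> int r - 1) \<longrightarrow>
           (\<exists>A. almost_fair_splitting N m V r A \<and> (\<forall>i\<in>{1..r}. path_stable N s (A i)))"
    and "r > 0" and fin: "finite A"
    and disj: "disjoint_family_on V {1..m}" and cover: "A \<subseteq> (\<Union>j\<in>{1..m}. V j)"
    and large: "\<And>j. j \<in> {1..m} \<Longrightarrow> r \<le> card (A \<inter> V j) + 1"
  obtains S where
    "\<And>k. k \<in> {1..r} \<Longrightarrow> S k \<subseteq> A" "disjoint_family_on S {1..r}"
    "\<And>k j. k \<in> {1..r} \<Longrightarrow> j \<in> {1..m} \<Longrightarrow> (card (A \<inter> V j) + 1) div r \<le> card (S k \<inter> V j) + 1"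
    "\<And>j. j \<in> {1..m} \<Longrightarrow> card (A \<inter> V j - (\<Union>k\<in>{1..r}. S k)) + 1 \<le> r"
    "\<And>k x y. k \<in> {1..r} \<Longrightarrow> x \<in> S k \<Longrightarrow> y \<in> S k \<Longrightarrow> x < y \<Longrightarrow> s \<le> card {a \<in> A. x < a \<and> a \<le> y}"
proof (cases "A = {}")
  case True
  \<comment> \<open>A path has at least one vertex, so \<open>split\<close> cannot be applied to an
    empty \<open>A\<close>. Empty sets work: the fairness bounds become
    \<open>1 div r \<le> 1\<close> and \<open>1 \<le> r\<close>.\<close>
  have "Suc 0 div r \<le> Suc 0" by (metis div_le_dividend)
  then show thesis
    using True \<open>r > 0\<close> by (intro that[of "\<lambda>_. {}"]) (auto simp: disjoint_family_on_def)
next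
  case False
  define \<rho> where "\<rho> x = card {a \<in> A. a \<le> x}" for x
  have \<rho>: "inj_on \<rho> A" "\<rho> ` A = {1..card A}"
    using rank_bij_betw[OF fin] unfolding bij_betw_def \<rho>_def by blast+
  define W where "W j = \<rho> ` (A \<inter> V j)" for j
  have "path_partition (card A) m W"
    unfolding path_partition_def
  proof (intro conjI)
    show "1 \<le> card A" using False fin by (simp add: Suc_leI card_gt_0_iff)
    show "disjoint_family_on W {1..m}"
      unfolding disjoint_family_on_def
    proof (intro ballI impI)
      fix j j' assume "j \<in> {1..m}" "j' \<in> {1..m}" "j \<noteq> j'"
      then have "V j \<inter> V j' = {}" using disj by (auto simp: disjoint_family_on_def)
      then show "W j \<inter> W j' = {}"
        unfolding W_def using \<rho>(1) by (subst inj_on_image_Int[symmetric, of \<rho> A]) auto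
    qed
    have "(\<Union>j\<in>{1..m}. W j) = \<rho> ` A" unfolding W_def using cover by blast
    then show "(\<Union>j\<in>{1..m}. W j) = {1..card A}" using \<rho>(2) by simp
  qed
  moreover have cardW: "card (W j) = card (A \<inter> V j)" for j
    unfolding W_def by (intro card_image inj_on_subset[OF \<rho>(1)]) auto
  ultimately obtain B where B: "almost_fair_splitting (card A) m W r B"
      "\<forall>k\<in>{1..r}. path_stable (card A) s (B k)"
    using split large by (smt (verit) of_nat_1 of_nat_add of_nat_mono)
  note B' = B(1)[unfolded almost_fair_splitting_iff]
  \<comment> \<open>Preimages under the rank map; its injectivity on \<open>A\<close> transfers all
    cardinalities between \<open>S\<close>, \<open>V\<close> and \<open>B\<close>,
    \<open>W\<close>.\<close>
  define S where "S k = {x \<in> A. \<rho> x \<in> B k}" for k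
  have image_S: "\<rho> ` (S k \<inter> V j) = B k \<inter> W j" if "k \<in> {1..r}" for k j
    unfolding S_def W_def by auto
  have cardS: "card (S k \<inter> V j) = card (B k \<inter> W j)" if "k \<in> {1..r}" for k j
    unfolding image_S[OF that, symmetric]
    by (intro card_image[symmetric] inj_on_subset[OF \<rho>(1)]) (auto simp: S_def)
  have rest: "card (A \<inter> V j - (\<Union>k\<in>{1..r}. S k)) = card (W j - (\<Union>k\<in>{1..r}. B k))" for j
  proof -
    have "\<rho> ` (A \<inter> V j - (\<Union>k\<in>{1..r}. S k)) = W j - (\<Union>k\<in>{1..r}. B k)"
      unfolding S_def W_def by auto
    then show ?thesis
      by (metis (no_types, lifting) Diff_subset Int_lower1 \<rho>(1) card_image inj_on_subset)
  qed
  show thesis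
  proof (rule that[of S])
    show "S k \<subseteq> A" for k by (auto simp: S_def)
    show "disjoint_family_on S {1..r}"
      using B' by (fastforce simp: disjoint_family_on_def S_def)
    show "(card (A \<inter> V j) + 1) div r \<le> card (S k \<inter> V j) + 1"
      if "k \<in> {1..r}" "j \<in> {1..m}" for k j
      using B' that cardS cardW by metis
    show "card (A \<inter> V j - (\<Union>k\<in>{1..r}. S k)) + 1 \<le> r" if "j \<in> {1..m}" for j
      using B' that unfolding rest by blast
    show "s \<le> card {a \<in> A. x < a \<and> a \<le> y}"
      if "k \<in> {1..r}" "x \<in> S k" "y \<in> S k" "x < y" for k x y
    proof -
      \<comment> \<open>The elements up to \<open>y\<close> are those up to \<open>x\<close> and
        those after \<open>x\<close>, so the rank difference is the required count.\<close>
      have "{a \<in> A. a \<le> y} = {a \<in> A. a \<le> x} \<union> {a \<in> A. x < a \<and> a \<le> y}"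
        using \<open>x < y\<close> by auto
      then have eq: "\<rho> y = \<rho> x + card {a \<in> A. x < a \<and> a \<le> y}"
        unfolding \<rho>_def using fin by (simp add: card_Un_disjoint disjoint_iff)
      have "\<rho> x \<noteq> \<rho> y"
        using that \<rho>(1) by (auto simp: S_def dest: inj_onD)
      then have "\<rho> x < \<rho> y" using eq by linarith
      moreover have "\<rho> x \<in> B k" "\<rho> y \<in> B k" using that by (auto simp: S_def)
      ultimately have "\<rho> x + s \<le> \<rho> y"
        using B(2) \<open>k \<in> {1..r}\<close> by (auto simp: path_stable_iff)
      then show ?thesis using eq by linarith
    qed
  qed
qed

section \<open>The two-stage splitting\<close>

text \<open>The common core of both claims. It only counts the steps inside one \<open>A i\<close>
  between two vertices of \<open>S p\<close>; how far each step reaches in the original path is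
  supplied separately, by \<open>s1\<close>-stability or by weak stability.\<close>

lemma refine_splitting:
  assumes split: "\<forall>N V. path_partition N m V \<and> (\<forall>j\<in>{1..m}. int (card (V j)) \<ge> int q2 - 1) \<longrightarrow>
           (\<exists>A. almost_fair_splitting N m V q2 A \<and> (\<forall>i\<in>{1..q2}. path_stable N s2 (A i)))"
    and "q1 > 0" "q2 > 0"
    and part: "path_partition N m V"
    and large: "\<forall>j\<in>{1..m}. int (card (V j)) \<ge> int (q1 * q2) - 1"
    and A: "almost_fair_splitting N m V q1 A"
  obtains S where "almost_fair_splitting N m V (q1 * q2) S"
    "\<And>p. p \<in> {1..q1 * q2} \<Longrightarrow> \<exists>i\<in>{1..q1}. S p \<subseteq> A i \<and>
       (\<forall>x\<in>S p. \<forall>y\<in>S p. x < y \<longrightarrow> s2 \<le> card {a \<in> A i. x < a \<and> a \<le> y})"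
proof -
  note A' = A[unfolded almost_fair_splitting_iff]
  have disj: "disjoint_family_on V {1..m}" and cover: "(\<Union>j\<in>{1..m}. V j) = {1..N}"
    using part by (auto simp: path_partition_def)
  have finV: "finite (V j)" if "j \<in> {1..m}" for j
    using cover that by (metis UN_upper finite_atLeastAtMost finite_subset)
  have "\<exists>T. (\<forall>k\<in>{1..q2}. T k \<subseteq> A i) \<and> disjoint_family_on T {1..q2} \<and>
      (\<forall>k\<in>{1..q2}. \<forall>j\<in>{1..m}. (card (A i \<inter> V j) + 1) div q2 \<le> card (T k \<inter> V j) + 1) \<and>
      (\<forall>j\<in>{1..m}. card (A i \<inter> V j - (\<Union>k\<in>{1..q2}. T k)) + 1 \<le> q2) \<and>
      (\<forall>k\<in>{1..q2}. \<forall>x\<in>T k. \<forall>y\<in>T k. x < y \<longrightarrow> s2 \<le> card {a \<in> A i. x < a \<and> a \<le> y})"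
    if i: "i \<in> {1..q1}" for i
  proof (rule split_vertex_subset[OF split \<open>q2 > 0\<close> _ disj, of "A i"])
    have sub: "A i \<subseteq> {1..N}" using A' i by blast
    then show "finite (A i)" by (rule finite_subset) simp
    show "A i \<subseteq> (\<Union>j\<in>{1..m}. V j)" using sub cover by simp
    show "q2 \<le> card (A i \<inter> V j) + 1" if j: "j \<in> {1..m}" for j
    proof -
      \<comment> \<open>Dividing the size bound by \<open>q1\<close> gives exactly the size bound
        that the second splitting requires.\<close>
      have "int (q1 * q2) \<le> int (card (V j) + 1)" using large j by force
      then have "q1 * q2 \<le> card (V j) + 1" by (simp only: of_nat_le_iff)
      then have "q1 * q2 div q1 \<le> (card (V j) + 1) div q1" by (rule div_le_mono)
      also have "\<dots> \<le> card (A i \<inter> V j) + 1" using A' i j by blast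
      finally show ?thesis using \<open>q1 > 0\<close> by simp
    qed
  qed blast
  then obtain T where "\<forall>i\<in>{1..q1}. (\<forall>k\<in>{1..q2}. T i k \<subseteq> A i) \<and> disjoint_family_on (T i) {1..q2} \<and>
      (\<forall>k\<in>{1..q2}. \<forall>j\<in>{1..m}. (card (A i \<inter> V j) + 1) div q2 \<le> card (T i k \<inter> V j) + 1) \<and>
      (\<forall>j\<in>{1..m}. card (A i \<inter> V j - (\<Union>k\<in>{1..q2}. T i k)) + 1 \<le> q2) \<and>
      (\<forall>k\<in>{1..q2}. \<forall>x\<in>T i k. \<forall>y\<in>T i k. x < y \<longrightarrow> s2 \<le> card {a \<in> A i. x < a \<and> a \<le> y})"
    by (rule bchoice[OF ballI, THEN exE])
  then have
    T: "\<And>i k. i \<in> {1..q1} \<Longrightarrow> k \<in> {1..q2} \<Longrightarrow> T i k \<subseteq> A i"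
       "\<And>i. i \<in> {1..q1} \<Longrightarrow> disjoint_family_on (T i) {1..q2}"
       "\<And>i k j. i \<in> {1..q1} \<Longrightarrow> k \<in> {1..q2} \<Longrightarrow> j \<in> {1..m} \<Longrightarrow>
          (card (A i \<inter> V j) + 1) div q2 \<le> card (T i k \<inter> V j) + 1"
       "\<And>i j. i \<in> {1..q1} \<Longrightarrow> j \<in> {1..m} \<Longrightarrow>
          card (A i \<inter> V j - (\<Union>k\<in>{1..q2}. T i k)) + 1 \<le> q2"
       "\<And>i k x y. i \<in> {1..q1} \<Longrightarrow> k \<in> {1..q2} \<Longrightarrow> x \<in> T i k \<Longrightarrow> y \<in> T i k \<Longrightarrow> x < y \<Longrightarrow>
          s2 \<le> card {a \<in> A i. x < a \<and> a \<le> y}"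
    by blast+
  \<comment> \<open>The index \<open>p - 1\<close> is written in base \<open>q2\<close>: the
    quotient selects \<open>A i\<close>, the remainder its subset \<open>T i k\<close>. The shifts
    by 1 account for one-based indexing.\<close>
  define c where "c p = (p - 1) div q2 + 1" for p
  define d where "d p = (p - 1) mod q2 + 1" for p
  have c: "c p \<in> {1..q1}" if "p \<in> {1..q1 * q2}" for p
  proof -
    have "p - 1 < q1 * q2" using that by auto
    then have "(p - 1) div q2 < q1" by (simp add: less_mult_imp_div_less)
    then show ?thesis by (simp add: c_def)
  qed
  have d: "d p \<in> {1..q2}" for p
    using \<open>q2 > 0\<close> by (simp add: d_def Suc_leI)
  have cd_inj: "p = p'"
    if "p \<in> {1..q1 * q2}" "p' \<in> {1..q1 * q2}" "c p = c p'" "d p = d p'" for p p'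
  proof -
    have "p - 1 = p' - 1"
      using that(3,4) by (metis Suc_eq_plus1 c_def d_def div_mod_decomp nat.inject)
    then show ?thesis using that(1,2) by auto
  qed
  have cd_surj: "\<exists>p\<in>{1..q1 * q2}. c p = i \<and> d p = k" if "i \<in> {1..q1}" "k \<in> {1..q2}" for i k
  proof -
    obtain i' k' where ik: "i = Suc i'" "k = Suc k'" "i' < q1" "k' < q2"
      by (rule that[of "i - 1" "k - 1"]) (use \<open>i \<in> {1..q1}\<close> \<open>k \<in> {1..q2}\<close> in auto)
    have "Suc (i' * q2 + k') \<le> Suc i' * q2" using ik(4) by simp
    also have "\<dots> \<le> q1 * q2" using ik(3) by (intro mult_le_mono1) simp
    finally have "Suc (i' * q2 + k') \<in> {1..q1 * q2}" by simp
    moreover have "c (Suc (i' * q2 + k')) = i" "d (Suc (i' * q2 + k')) = k"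
      using ik by (simp_all add: c_def d_def)
    ultimately show ?thesis by blast
  qed
  define S where "S p = T (c p) (d p)" for p
  have SA: "S p \<subseteq> A (c p)" if "p \<in> {1..q1 * q2}" for p
    unfolding S_def using T(1) c[OF that] d by blast
  have "almost_fair_splitting N m V (q1 * q2) S"
    unfolding almost_fair_splitting_iff
  proof (intro conjI ballI)
    fix p assume "p \<in> {1..q1 * q2}"
    then show "S p \<subseteq> {1..N}" using SA c A' by blast
  next
    show "disjoint_family_on S {1..q1 * q2}"
      unfolding disjoint_family_on_def
    proof (intro ballI impI)
      fix p p' assume pp: "p \<in> {1..q1 * q2}" "p' \<in> {1..q1 * q2}" "p \<noteq> p'"
      show "S p \<inter> S p' = {}"
      proof (cases "c p = c p'")
        case True
        then have "d p \<noteq> d p'" using cd_inj pp by blast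
        then show ?thesis
          using T(2)[OF c[OF pp(1)]] d True by (auto simp: S_def disjoint_family_on_def)
      next
        case False
        then have "A (c p) \<inter> A (c p') = {}"
          using A' c pp by (auto simp: disjoint_family_on_def)
        then show ?thesis using SA pp by blast
      qed
    qed
  next
    fix p j assume p: "p \<in> {1..q1 * q2}" and j: "j \<in> {1..m}"
    have "(card (V j) + 1) div (q1 * q2) = (card (V j) + 1) div q1 div q2"
      by (rule div_mult2_eq)
    also have "\<dots> \<le> (card (A (c p) \<inter> V j) + 1) div q2"
      using A' c[OF p] j by (intro div_le_mono) blast
    also have "\<dots> \<le> card (S p \<inter> V j) + 1"
      unfolding S_def by (rule T(3)[OF c[OF p] d j])
    finally show "(card (V j) + 1) div (q1 * q2) \<le> card (S p \<inter> V j) + 1" .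
  next
    fix j assume j: "j \<in> {1..m}"
    let ?R = "\<lambda>i. A i \<inter> V j - (\<Union>k\<in>{1..q2}. T i k)"
    let ?Q = "V j - (\<Union>i\<in>{1..q1}. A i)"
    \<comment> \<open>A lost vertex is missed by every \<open>A i\<close>, or lies in some
      \<open>A i\<close> and is missed by all of its \<open>T i k\<close>.\<close>
    have "V j - (\<Union>p\<in>{1..q1 * q2}. S p) \<subseteq> ?Q \<union> (\<Union>i\<in>{1..q1}. ?R i)"
    proof
      fix x assume x: "x \<in> V j - (\<Union>p\<in>{1..q1 * q2}. S p)"
      have "x \<notin> T i k" if "i \<in> {1..q1}" "k \<in> {1..q2}" for i k
        using cd_surj[OF that] x by (auto simp: S_def)
      then show "x \<in> ?Q \<union> (\<Union>i\<in>{1..q1}. ?R i)" using x by blast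
    qed
    then have "card (V j - (\<Union>p\<in>{1..q1 * q2}. S p)) \<le> card (?Q \<union> (\<Union>i\<in>{1..q1}. ?R i))"
      using finV[OF j] by (intro card_mono) auto
    also have "\<dots> \<le> card ?Q + card (\<Union>i\<in>{1..q1}. ?R i)" by (rule card_Un_le)
    also have "card (\<Union>i\<in>{1..q1}. ?R i) \<le> (\<Sum>i\<in>{1..q1}. card (?R i))"
      by (rule card_UN_le) simp
    also have "\<dots> \<le> (\<Sum>i\<in>{1..q1}. q2 - 1)"
    proof (rule sum_mono)
      fix i assume "i \<in> {1..q1}"
      from T(4)[OF this j] show "card (?R i) \<le> q2 - 1" by linarith
    qed
    finally have "card (V j - (\<Union>p\<in>{1..q1 * q2}. S p)) + 1 \<le> (card ?Q + 1) + q1 * (q2 - 1)"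
      by simp
    also have "\<dots> \<le> q1 + q1 * (q2 - 1)" using A' j by simp
    \<comment> \<open>Positivity of \<open>q2\<close> makes the truncated \<open>q2 - 1\<close> a
      true difference.\<close>
    also have "\<dots> = q1 * q2" using \<open>q2 > 0\<close> by (cases q2) simp_all
    finally show "card (V j - (\<Union>p\<in>{1..q1 * q2}. S p)) + 1 \<le> q1 * q2" .
  qed
  moreover have "\<exists>i\<in>{1..q1}. S p \<subseteq> A i \<and>
       (\<forall>x\<in>S p. \<forall>y\<in>S p. x < y \<longrightarrow> s2 \<le> card {a \<in> A i. x < a \<and> a \<le> y})"
    if "p \<in> {1..q1 * q2}" for p
    using c[OF that] SA[OF that] T(5)[OF c[OF that] d] unfolding S_def by blast
  ultimately show thesis by (rule that)
qed

section \<open>Gaps from weak stability\<close>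

text \<open>The half-open windows \<open>{(w - 1) (k - 1) + 1..(w - 1) k}\<close> are disjoint, so consecutive elements of
  \<open>A i\<close> lie in windows of strictly increasing index; this gains the final \<open>+ 1\<close> over the
  bound given by the overlapping closed windows.\<close>

lemma weakly_stable_gap:
  fixes A :: "nat \<Rightarrow> nat set"
  assumes weak: "weakly_stable w r A" and "w \<ge> 2" and i: "i \<in> {1..r}"
    and xy: "x \<in> A i" "y \<in> A i" "x < y"
    and far: "s \<le> card {a \<in> A i. x < a \<and> a \<le> y}"
  shows "x + ((s - 1) * (w - 1) + 1) \<le> y"
proof -
  define U where "U = (\<Union>i\<in>{1..r}. A i)"
  define v where "v = int w - 1"
  have "v > 0" using \<open>w \<ge> 2\<close> by (simp add: v_def)
  obtain n :: int and \<phi> :: "nat \<Rightarrow> int" where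
    bij: "bij_betw \<phi> U {1..v * n + 1}" and mono: "strict_mono_on U \<phi>" and
    one: "\<And>k. k \<in> {1..n} \<Longrightarrow> card (\<phi> ` A i \<inter> {v * (k - 1) + 1..v * k + 1}) = 1"
    using weak i unfolding weakly_stable_def U_def v_def by metis
  have AU: "A i \<subseteq> U" using i by (auto simp: U_def)
  have range: "1 \<le> \<phi> a" "\<phi> a \<le> v * n + 1" if "a \<in> U" for a
    using bij_betwE[OF bij] that by auto
  \<comment> \<open>The index of the half-open window containing \<open>\<phi> a\<close>; positions
    start at 1, hence the shift before dividing.\<close>
  define \<kappa> where "\<kappa> a = (\<phi> a - 1) div v + 1" for a
  have \<kappa>: "v * (\<kappa> a - 1) + 1 \<le> \<phi> a" "\<phi> a \<le> v * \<kappa> a" for a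
  proof -
    have *: "v * ((\<phi> a - 1) div v) + (\<phi> a - 1) mod v = \<phi> a - 1" by simp
    have "0 \<le> (\<phi> a - 1) mod v" "(\<phi> a - 1) mod v < v" using \<open>v > 0\<close> by simp_all
    moreover have "v * \<kappa> a = v * (\<kappa> a - 1) + v" by (simp add: right_diff_distrib)
    moreover have "v * (\<kappa> a - 1) = v * ((\<phi> a - 1) div v)" by (simp add: \<kappa>_def)
    ultimately show "v * (\<kappa> a - 1) + 1 \<le> \<phi> a" "\<phi> a \<le> v * \<kappa> a"
      using * by linarith+
  qed
  \<comment> \<open>Otherwise monotonicity puts both positions in the same half-open window, and the
    closed window around it would contain two points of the image of \<open>A i\<close>.\<close>
  have step: "\<kappa> a + 1 \<le> \<kappa> b" if ab: "a \<in> A i" "b \<in> A i" "a < b" for a b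
  proof (rule ccontr)
    assume "\<not> \<kappa> a + 1 \<le> \<kappa> b"
    moreover have less: "\<phi> a < \<phi> b"
      using mono ab AU by (auto simp: strict_mono_on_def)
    then have "\<kappa> a \<le> \<kappa> b" unfolding \<kappa>_def using \<open>v > 0\<close> by (simp add: zdiv_mono1)
    ultimately have eq: "\<kappa> b = \<kappa> a" by simp
    have "1 \<le> \<kappa> a"
      using range(1)[of a] ab AU \<open>v > 0\<close> by (auto simp: \<kappa>_def pos_imp_zdiv_nonneg_iff)
    \<comment> \<open>The last position \<open>v * n + 1\<close> has index \<open>n + 1\<close>,
      beyond the range of \<open>one\<close>. Since \<open>\<phi> a < \<phi> b\<close>, the position
      of \<open>a\<close> is not the last.\<close>
    moreover have "\<kappa> a \<le> n"
    proof -
      have "\<phi> b \<le> v * n + 1" using range(2) ab AU by blast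
      then have "v * (\<kappa> a - 1) < v * n" using \<kappa>(1)[of a] less by linarith
      then show ?thesis using \<open>v > 0\<close> by simp
    qed
    ultimately have "card (\<phi> ` A i \<inter> {v * (\<kappa> a - 1) + 1..v * \<kappa> a + 1}) = 1"
      by (intro one) simp
    then obtain z where z: "\<phi> ` A i \<inter> {v * (\<kappa> a - 1) + 1..v * \<kappa> a + 1} = {z}"
      by (auto simp: card_1_singleton_iff)
    have "\<phi> a \<in> \<phi> ` A i \<inter> {v * (\<kappa> a - 1) + 1..v * \<kappa> a + 1}"
      using ab \<kappa>[of a] by auto
    moreover have "\<phi> b \<in> \<phi> ` A i \<inter> {v * (\<kappa> a - 1) + 1..v * \<kappa> a + 1}"
      using ab \<kappa>[of b] eq by auto
    ultimately show False using less unfolding z by simp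
  qed
  define e where "e = int (card {a \<in> A i. x < a \<and> a \<le> y})"
  have "\<kappa> x + 1 * e \<le> \<kappa> y"
    unfolding e_def using step xy by (intro gap_mult_card_le[of "A i"]) auto
  \<comment> \<open>This covers \<open>s = 0\<close>, where truncated \<open>s - 1\<close> is 0 and
    \<open>s \<le> e\<close> alone would be too weak.\<close>
  moreover have "e \<ge> 1"
  proof -
    have "card {y} \<le> card {a \<in> A i. x < a \<and> a \<le> y}"
      using xy by (intro card_mono) auto
    then show ?thesis by (simp add: e_def)
  qed
  moreover have "int s \<le> e" using far by (simp add: e_def)
  ultimately have "int (s - 1) \<le> \<kappa> y - 1 - \<kappa> x" by linarith
  then have "v * int (s - 1) \<le> v * (\<kappa> y - 1 - \<kappa> x)"
    using \<open>v > 0\<close> by (intro mult_left_mono) auto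
  also have "\<dots> = v * (\<kappa> y - 1) - v * \<kappa> x" by (rule right_diff_distrib)
  \<comment> \<open>From the end of the window of \<open>x\<close> to the start of that of
    \<open>y\<close> there are \<open>\<kappa> y - 1 - \<kappa> x\<close> full windows and one
    further position.\<close>
  finally have "v * int (s - 1) + 1 \<le> \<phi> y - \<phi> x" using \<kappa>(1)[of y] \<kappa>(2)[of x] by linarith
  \<comment> \<open>Every integer in between is a position of some vertex of \<open>U\<close>, and
    monotonicity places that vertex between \<open>x\<close> and \<open>y\<close>; so positions
    advance no faster than labels.\<close>
  also have "\<phi> y - \<phi> x \<le> int (y - x)"
  proof -
    have "{\<phi> x<..\<phi> y} \<subseteq> \<phi> ` {x<..y}"
    proof
      fix t assume t: "t \<in> {\<phi> x<..\<phi> y}"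
      have xyU: "x \<in> U" "y \<in> U" using xy AU by auto
      have "t \<in> {1..v * n + 1}" using t range(1)[OF xyU(1)] range(2)[OF xyU(2)] by auto
      then obtain u where u: "u \<in> U" "t = \<phi> u"
        using bij_betw_imp_surj_on[OF bij] by blast
      have "x < u" "u \<le> y"
        using t u xyU strict_mono_on_less[OF mono] strict_mono_on_less_eq[OF mono] by auto
      then show "t \<in> \<phi> ` {x<..y}" using u by auto
    qed
    then have "card {\<phi> x<..\<phi> y} \<le> card {x<..y}"
      by (intro surj_card_le) auto
    then show ?thesis by simp
  qed
  finally have "v * int (s - 1) + 1 \<le> int (y - x)" .
  moreover have "v = int (w - 1)" using \<open>w \<ge> 2\<close> by (simp add: v_def)
  ultimately have "int ((w - 1) * (s - 1) + 1) \<le> int (y - x)" by simp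
  then have "(w - 1) * (s - 1) + 1 \<le> y - x" by (simp only: of_nat_le_iff)
  then show ?thesis using xy by (simp add: mult.commute)
qed

section \<open>Combining the refinement with the two gap bounds\<close>

theorem theorem6p6:
  fixes m q1 q2 s1 s2 q s :: nat
  assumes "m > 0" and "q1 > 0" and "q2 > 0" and "s1 > 0" and "s2 > 0"
    and "q = q1 * q2" and "s = s1 * s2"
    and "\<forall>N V. path_partition N m V \<and> (\<forall>j\<in>{1..m}. int (card (V j)) \<ge> int q1 - 1) \<longrightarrow>
           (\<exists>A. almost_fair_splitting N m V q1 A \<and> (\<forall>i\<in>{1..q1}. path_stable N s1 (A i)))"
    and "\<forall>N V. path_partition N m V \<and> (\<forall>j\<in>{1..m}. int (card (V j)) \<ge> int q2 - 1) \<longrightarrow>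
           (\<exists>A. almost_fair_splitting N m V q2 A \<and> (\<forall>i\<in>{1..q2}. path_stable N s2 (A i)))"
  shows "(\<forall>N V. path_partition N m V \<and> (\<forall>j\<in>{1..m}. int (card (V j)) \<ge> int q - 1) \<longrightarrow>
            (\<exists>S. almost_fair_splitting N m V q S \<and> (\<forall>i\<in>{1..q}. path_stable N s (S i)))) \<and>
         (\<forall>w1\<ge>2.
            (\<forall>N V. path_partition N m V \<and> (\<forall>j\<in>{1..m}. int (card (V j)) \<ge> int q1 - 1) \<longrightarrow>
               (\<exists>A. almost_fair_splitting N m V q1 A \<and> (\<forall>i\<in>{1..q1}. path_stable N s1 (A i)) \<and>
                    weakly_stable w1 q1 A)) \<longrightarrow>
            (\<forall>N V. path_partition N m V \<and> (\<forall>j\<in>{1..m}. int (card (V j)) \<ge> int q - 1) \<longrightarrow>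
               (\<exists>S. almost_fair_splitting N m V q S \<and>
                    (\<forall>i\<in>{1..q}. path_stable N ((s2 - 1) * (w1 - 1) + 1) (S i)))))"
proof (intro conjI allI impI)
  fix N V
  assume V: "path_partition N m V \<and> (\<forall>j\<in>{1..m}. int (card (V j)) \<ge> int q - 1)"
  have "q1 \<le> q" using assms(3,6) by simp
  then have "\<forall>j\<in>{1..m}. int (card (V j)) \<ge> int q1 - 1" using V by force
  then obtain A where A: "almost_fair_splitting N m V q1 A" "\<forall>i\<in>{1..q1}. path_stable N s1 (A i)"
    using assms(8) V by blast
  obtain S where S: "almost_fair_splitting N m V q S"
    "\<And>p. p \<in> {1..q} \<Longrightarrow> \<exists>i\<in>{1..q1}. S p \<subseteq> A i \<and>
       (\<forall>x\<in>S p. \<forall>y\<in>S p. x < y \<longrightarrow> s2 \<le> card {a \<in> A i. x < a \<and> a \<le> y})"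
    using V by (auto intro: refine_splitting[OF assms(9,2,3) _ _ A(1), folded assms(6)])
  have "path_stable N s (S p)" if p: "p \<in> {1..q}" for p
    unfolding path_stable_iff
  proof (intro conjI ballI impI)
    show "S p \<subseteq> {1..N}" using S(1) p by (simp add: almost_fair_splitting_def)
    fix x y assume xy: "x \<in> S p" "y \<in> S p" "x < y"
    then obtain i where i: "i \<in> {1..q1}" "x \<in> A i" "y \<in> A i"
      "s2 \<le> card {a \<in> A i. x < a \<and> a \<le> y}"
      using S(2)[OF p] by blast
    \<comment> \<open>Each step inside \<open>A i\<close> has length at least \<open>s1\<close>, and
      there are at least \<open>s2\<close> steps from \<open>x\<close> to \<open>y\<close>.\<close>
    have "int u + int s1 \<le> int v" if "u \<in> A i" "v \<in> A i" "u < v" for u v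
    proof -
      have "u + s1 \<le> v" using A(2) i(1) that by (auto simp: path_stable_iff)
      then show ?thesis by linarith
    qed
    then have "int x + int s1 * int (card {a \<in> A i. x < a \<and> a \<le> y}) \<le> int y"
      using i(2,3) \<open>x < y\<close> by (intro gap_mult_card_le) auto
    moreover have "int s1 * int s2 \<le> int s1 * int (card {a \<in> A i. x < a \<and> a \<le> y})"
      using i(4) by (intro mult_left_mono) auto
    ultimately have "int x + int s1 * int s2 \<le> int y" by linarith
    then show "x + s \<le> y" unfolding assms(7) by (metis of_nat_add of_nat_le_iff of_nat_mult)
  qed
  with S(1) show "\<exists>S. almost_fair_splitting N m V q S \<and> (\<forall>i\<in>{1..q}. path_stable N s (S i))"
    by blast
next
  fix w1 N :: nat and V
  assume w1: "2 \<le> w1"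
    and weak: "\<forall>N V. path_partition N m V \<and> (\<forall>j\<in>{1..m}. int (card (V j)) \<ge> int q1 - 1) \<longrightarrow>
               (\<exists>A. almost_fair_splitting N m V q1 A \<and> (\<forall>i\<in>{1..q1}. path_stable N s1 (A i)) \<and>
                    weakly_stable w1 q1 A)"
    and V: "path_partition N m V \<and> (\<forall>j\<in>{1..m}. int (card (V j)) \<ge> int q - 1)"
  have "q1 \<le> q" using assms(3,6) by simp
  then have "\<forall>j\<in>{1..m}. int (card (V j)) \<ge> int q1 - 1" using V by force
  then obtain A where A: "almost_fair_splitting N m V q1 A" "weakly_stable w1 q1 A"
    using weak V by blast
  \<comment> \<open>The same refinement, now of a weakly stable family; the count \<open>s2\<close>
    feeds the window argument.\<close>
  obtain S where S: "almost_fair_splitting N m V q S"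
    "\<And>p. p \<in> {1..q} \<Longrightarrow> \<exists>i\<in>{1..q1}. S p \<subseteq> A i \<and>
       (\<forall>x\<in>S p. \<forall>y\<in>S p. x < y \<longrightarrow> s2 \<le> card {a \<in> A i. x < a \<and> a \<le> y})"
    using V by (auto intro: refine_splitting[OF assms(9,2,3) _ _ A(1), folded assms(6)])
  have "path_stable N ((s2 - 1) * (w1 - 1) + 1) (S p)" if p: "p \<in> {1..q}" for p
    unfolding path_stable_iff
  proof (intro conjI ballI impI)
    show "S p \<subseteq> {1..N}" using S(1) p by (simp add: almost_fair_splitting_def)
    fix x y assume xy: "x \<in> S p" "y \<in> S p" "x < y"
    then obtain i where "i \<in> {1..q1}" "x \<in> A i" "y \<in> A i"
      "s2 \<le> card {a \<in> A i. x < a \<and> a \<le> y}"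
      using S(2)[OF p] by blast
    with \<open>x < y\<close> show "x + ((s2 - 1) * (w1 - 1) + 1) \<le> y"
      by (intro weakly_stable_gap[OF A(2) w1])
  qed
  with S(1) show "\<exists>S. almost_fair_splitting N m V q S \<and>
      (\<forall>i\<in>{1..q}. path_stable N ((s2 - 1) * (w1 - 1) + 1) (S i))"
    by blast
qed

end
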